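(* Assume that there exist $\lambda_0^{12}\in\mathbb{R}$, $\lambda_0^{21}\in\mathbb{R}$, $\lambda_1^{12}=\lambda_1^{21}\in\mathbb{R}^3$ and $\lambda_2^{12}=\lambda_2^{21}\in\mathbb{R}$ such that the pair $(M_{12},M_{21})$, where $$M_{kj}(v)=\exp\left(m_k\lambda^{kj}_0+m_k\lambda^{kj}_1\cdot v+m_k\lambda^{kj}_2|v|^2\right),\qquad v\in\mathbb{R}^3,$$ is an element of $\chi_{12}$. Then $(M_{12},M_{21})$ is the unique minimizer of the problem $$\min_{(g_1,g_2)\in\chi_{12}}\ \int_{\mathbb{R}^3}\nu_{12}\,h(g_1)\,dv+\int_{\mathbb{R}^3}\nu_{21}\,h(g_2)\,dv .$$
   Context: Here $m_1,m_2>0$ are particle masses, $\nu_{12},\nu_{21}:\mathbb{R}^3\to(0,\infty)$ are given measurable (velocity-dependent) collision frequencies, and $f_1,f_2:\mathbb{R}^3\to[0,\infty)$ are given measurable functions with $\nu_{12}(1+|v|^2)f_1,\ \nu_{21}(1+|v|^2)f_2\in L^1(\mathbb{R}^3)$. The entropy function is $h(z)=z\ln z-z$ for $z>0$. The admissible set is $$\chi_{12}=\Big\{(g_1,g_2)\ \Big|\ g_1,g_2>0,\ \nu_{12}(1+|v|^2)g_1,\ \nu_{21}(1+|v|^2)g_2\in L^1(\mathbb{R}^3),$$ $$\int m_1\nu_{12}g_1\,dv=\int m_1\nu_{12}f_1\,dv,\quad \int m_2\nu_{21}g_2\,dv=\int m_2\nu_{21}f_2\,dv,$$ $$\int m_1\nu_{12}\begin{pmatrix}v\\|v|^2\end{pmatrix}(g_1-f_1)\,dv+\int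 m_2\nu_{21}\begin{pmatrix}v\\|v|^2\end{pmatrix}(g_2-f_2)\,dv=0\Big\}.$$ Functions are identified when they agree almost everywhere, and the objective is an extended-real-valued integral (the value $+\infty$ is allowed). *)

theory Defs
  imports "HOL-Analysis.Analysis"
begin

text \<open>
  Measurability and integrals refer to the completed Lebesgue measure \<^const>\<open>lebesgue\<close> on
  \<^typ>\<open>real^3\<close>.  Functions are identified when they agree almost everywhere; this is rendered by
  working with representatives and stating pointwise conditions on them almost everywhere.
\<close>

definition entropy_h :: "real \<Rightarrow> real" where
  "entropy_h z = z * ln z - z"

text \<open>
  The integral as an extended real: the integral of the positive part minus that of the negative
  part.  If both parts have infinite integral, the value is \<open>\<infinity>\<close>, because \<open>\<infinity> - \<infinity> = \<infinity>\<close> in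
  \<^typ>\<open>ereal\<close>.
\<close>

definition ereal_integral :: "'a measure \<Rightarrow> ('a \<Rightarrow> real) \<Rightarrow> ereal" where
  "ereal_integral M f =
     enn2ereal (\<integral>\<^sup>+ x. ennreal (f x) \<partial>M) - enn2ereal (\<integral>\<^sup>+ x. ennreal (- f x) \<partial>M)"

definition entropy_functional ::
  "(real^3 \<Rightarrow> real) \<Rightarrow> (real^3 \<Rightarrow> real) \<Rightarrow> (real^3 \<Rightarrow> real) \<times> (real^3 \<Rightarrow> real) \<Rightarrow> ereal" where
  "entropy_functional \<nu>12 \<nu>21 = (\<lambda>(g1, g2).
     ereal_integral lebesgue (\<lambda>v. \<nu>12 v * entropy_h (g1 v)) +
     ereal_integral lebesgue (\<lambda>v. \<nu>21 v * entropy_h (g2 v)))"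

definition admissible ::
  "real \<Rightarrow> real \<Rightarrow> (real^3 \<Rightarrow> real) \<Rightarrow> (real^3 \<Rightarrow> real) \<Rightarrow> (real^3 \<Rightarrow> real) \<Rightarrow> (real^3 \<Rightarrow> real) \<Rightarrow>
   ((real^3 \<Rightarrow> real) \<times> (real^3 \<Rightarrow> real)) set" where
  "admissible m1 m2 \<nu>12 \<nu>21 f1 f2 = {(g1, g2).
     g1 \<in> borel_measurable lebesgue \<and> g2 \<in> borel_measurable lebesgue \<and>
     (AE v in lebesgue. 0 < g1 v) \<and> (AE v in lebesgue. 0 < g2 v) \<and>
     integrable lebesgue (\<lambda>v. \<nu>12 v * (1 + (norm v)\<^sup>2) * g1 v) \<and>
     integrable lebesgue (\<lambda>v. \<nu>21 v * (1 + (norm v)\<^sup>2) * g2 v) \<and>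
     (\<integral>v. m1 * \<nu>12 v * g1 v \<partial>lebesgue) = (\<integral>v. m1 * \<nu>12 v * f1 v \<partial>lebesgue) \<and>
     (\<integral>v. m2 * \<nu>21 v * g2 v \<partial>lebesgue) = (\<integral>v. m2 * \<nu>21 v * f2 v \<partial>lebesgue) \<and>
     (\<integral>v. (m1 * \<nu>12 v * (g1 v - f1 v)) *\<^sub>R v \<partial>lebesgue) +
       (\<integral>v. (m2 * \<nu>21 v * (g2 v - f2 v)) *\<^sub>R v \<partial>lebesgue) = 0 \<and>
     (\<integral>v. m1 * \<nu>12 v * (norm v)\<^sup>2 * (g1 v - f1 v) \<partial>lebesgue) +
       (\<integral>v. m2 * \<nu>21 v * (norm v)\<^sup>2 * (g2 v - f2 v) \<partial>lebesgue) = 0}"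

definition maxwellian :: "real \<Rightarrow> real \<Rightarrow> real^3 \<Rightarrow> real \<Rightarrow> real^3 \<Rightarrow> real" where
  "maxwellian m l0 l1 l2 v = exp (m * l0 + m * (l1 \<bullet> v) + m * l2 * (norm v)\<^sup>2)"

end

theory Submission
  imports Defs
begin

text \<open>
  Let \<open>B(z, w) = h(z) - h(w) - h'(w) (z - w) \<ge> 0\<close> be the Bregman divergence of \<open>h\<close>.  Since
  \<open>h'(M) = ln M\<close> is a combination of the collision invariants \<open>1, v, |v|\<^sup>2\<close> with common
  coefficients for \<open>v\<close> and \<open>|v|\<^sup>2\<close>, the constraints make the total integral of the affine part
  \<open>\<nu> (h(M) + ln M (g - M)) = \<nu> (g ln M - M)\<close> the same for all admissible pairs.  Hence the entropy
  of an admissible pair is a finite constant plus the integral of \<open>\<nu> B(g, M)\<close>, which vanishes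
  exactly when \<open>g = M\<close> almost everywhere.
\<close>

section \<open>The Bregman divergence of the entropy function\<close>

text \<open>Since h' = ln, the tangent h(w) + ln w (z - w) collapses to the subtracted term z ln w -
  w.\<close>

definition entropy_bregman :: "real \<Rightarrow> real \<Rightarrow> real" where
  "entropy_bregman z w = entropy_h z - (z * ln w - w)"

text \<open>In the ratio x = w / z, the sign and the equality case both reduce to ln x <= x - 1,
  with equality only at x = 1.\<close>

lemma entropy_bregman_eq:
  assumes "0 < z" "0 < w"
  shows "entropy_bregman z w = z * (w / z - 1 - ln (w / z))"
  using assms by (simp add: entropy_bregman_def entropy_h_def ln_div algebra_simps)

lemma entropy_bregman_nonneg:
  assumes "0 < z" "0 < w"
  shows "0 \<le> entropy_bregman z w"
  unfolding entropy_bregman_eq[OF assms]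
  using assms ln_le_minus_one[of "w / z"] by (intro mult_nonneg_nonneg) auto

lemma entropy_bregman_eq_0_iff:
  assumes "0 < z" "0 < w"
  shows "entropy_bregman z w = 0 \<longleftrightarrow> z = w"
proof
  assume "entropy_bregman z w = 0"
  then have "ln (w / z) = w / z - 1"
    using assms by (simp add: entropy_bregman_eq)
  then have "w / z = 1"
    using assms by (intro ln_eq_minus_one) auto
  then show "z = w"
    using assms by simp
qed (use assms in \<open>simp add: entropy_bregman_eq\<close>)

section \<open>Extended-real integrals and the entropy decomposition\<close>

lemma ereal_integral_eq_integral:
  assumes "integrable M f"
  shows "ereal_integral M f = ereal (integral\<^sup>L M f)"
proof -
  have "(\<integral>\<^sup>+ x. ennreal (f x) \<partial>M) \<noteq> \<infinity>" "(\<integral>\<^sup>+ x. ennreal (- f x) \<partial>M) \<noteq> \<infinity>"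
    using assms by (auto simp: real_integrable_def)
  then show ?thesis
    unfolding ereal_integral_def real_lebesgue_integral_def[OF assms]
    by (cases "\<integral>\<^sup>+ x. ennreal (f x) \<partial>M"; cases "\<integral>\<^sup>+ x. ennreal (- f x) \<partial>M") auto
qed

text \<open>The negative part of f + b is dominated by |f|, so no \<infinity> - \<infinity> arises
  and the integral splits even when b has infinite integral. This is how pairs of infinite entropy
  are covered.\<close>

lemma ereal_integral_add_nonneg:
  assumes f: "integrable M f"
    and b: "b \<in> borel_measurable M" "AE x in M. 0 \<le> b x"
  shows "ereal_integral M (\<lambda>x. f x + b x) =
    ereal (integral\<^sup>L M f) + enn2ereal (\<integral>\<^sup>+ x. ennreal (b x) \<partial>M)"
proof (cases "(\<integral>\<^sup>+ x. ennreal (b x) \<partial>M) = \<infinity>")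
  case False
  then have ib: "integrable M b"
    using b by (intro integrableI_nonneg) (auto simp: less_top)
  then have "(\<integral>\<^sup>+ x. ennreal (b x) \<partial>M) = ennreal (integral\<^sup>L M b)"
    using b by (intro nn_integral_eq_integral)
  moreover have "0 \<le> integral\<^sup>L M b"
    using b by (intro integral_nonneg_AE)
  ultimately show ?thesis
    using f ib by (simp add: ereal_integral_eq_integral)
next
  case True
  note [measurable] = borel_measurable_integrable[OF f] b(1)
  have fin: "(\<integral>\<^sup>+ x. ennreal \<bar>f x\<bar> \<partial>M) < \<infinity>"
    using f by (simp add: integrable_iff_bounded)
  \<comment> \<open>As |f| has finite integral, an infinite integral of b must come from the
    positive part of f + b.\<close>
  have "(\<integral>\<^sup>+ x. ennreal (b x) \<partial>M) \<le> (\<integral>\<^sup>+ x. ennreal (f x + b x) + ennreal \<bar>f x\<bar> \<partial>M)"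
  proof (rule nn_integral_mono)
    show "ennreal (b x) \<le> ennreal (f x + b x) + ennreal \<bar>f x\<bar>" for x
      \<comment> \<open>\<open>ennreal\<close> truncates negative values to 0; where f + b < 0 the
        bound is b <= -f <= |f|.\<close>
      by (cases "0 \<le> f x + b x")
        (auto simp flip: ennreal_plus simp: ennreal_neg intro!: ennreal_leI)
  qed
  also have "\<dots> = (\<integral>\<^sup>+ x. ennreal (f x + b x) \<partial>M) + (\<integral>\<^sup>+ x. ennreal \<bar>f x\<bar> \<partial>M)"
    by (intro nn_integral_add) auto
  finally have pos: "(\<integral>\<^sup>+ x. ennreal (f x + b x) \<partial>M) = \<infinity>"
    using True fin by (auto simp: top_unique)
  have "(\<integral>\<^sup>+ x. ennreal (- (f x + b x)) \<partial>M) \<le> (\<integral>\<^sup>+ x. ennreal \<bar>f x\<bar> \<partial>M)"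
    using b(2) by (intro nn_integral_mono_AE) (auto elim!: eventually_mono intro!: ennreal_leI)
  then have "(\<integral>\<^sup>+ x. ennreal (- (f x + b x)) \<partial>M) < \<infinity>"
    using fin by (rule le_less_trans)
  with pos True show ?thesis
    by (cases "\<integral>\<^sup>+ x. ennreal (- (f x + b x)) \<partial>M") (simp_all add: ereal_integral_def)
qed

text \<open>Only the tangent part at w has to be integrable; a possibly infinite entropy is carried
  by the nonnegative divergence alone.\<close>

lemma entropy_integral_eq_affine_plus_bregman:
  assumes [measurable]: "\<nu> \<in> borel_measurable N" "g \<in> borel_measurable N" "w \<in> borel_measurable N"
    and pos: "\<And>v. 0 < \<nu> v" "AE v in N. 0 < g v" "\<And>v. 0 < w v"
    and int: "integrable N (\<lambda>v. \<nu> v * g v * ln (w v))" "integrable N (\<lambda>v. \<nu> v * w v)"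
  shows "ereal_integral N (\<lambda>v. \<nu> v * entropy_h (g v)) =
    ereal ((\<integral>v. \<nu> v * g v * ln (w v) \<partial>N) - (\<integral>v. \<nu> v * w v \<partial>N)) +
    enn2ereal (\<integral>\<^sup>+ v. ennreal (\<nu> v * entropy_bregman (g v) (w v)) \<partial>N)"
proof -
  have "(\<lambda>v. \<nu> v * entropy_h (g v)) =
      (\<lambda>v. (\<nu> v * g v * ln (w v) - \<nu> v * w v) + \<nu> v * entropy_bregman (g v) (w v))"
    by (simp add: entropy_bregman_def algebra_simps)
  moreover have "AE v in N. 0 \<le> \<nu> v * entropy_bregman (g v) (w v)"
    using pos(2) by eventually_elim
      (intro mult_nonneg_nonneg entropy_bregman_nonneg less_imp_le[OF pos(1)] pos(3))
  moreover have "(\<lambda>v. \<nu> v * entropy_bregman (g v) (w v)) \<in> borel_measurable N"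
    unfolding entropy_bregman_def entropy_h_def by measurable
  ultimately show ?thesis
    using int by (simp add: ereal_integral_add_nonneg)
qed

lemma bregman_integral_eq_0_iff:
  assumes [measurable]: "\<nu> \<in> borel_measurable N" "g \<in> borel_measurable N" "w \<in> borel_measurable N"
    and pos: "\<And>v. 0 < \<nu> v" "AE v in N. 0 < g v" "\<And>v. 0 < w v"
  shows "(\<integral>\<^sup>+ v. ennreal (\<nu> v * entropy_bregman (g v) (w v)) \<partial>N) = 0 \<longleftrightarrow> (AE v in N. g v = w v)"
proof -
  have "(\<integral>\<^sup>+ v. ennreal (\<nu> v * entropy_bregman (g v) (w v)) \<partial>N) = 0 \<longleftrightarrow>
      (AE v in N. ennreal (\<nu> v * entropy_bregman (g v) (w v)) = 0)"
    unfolding entropy_bregman_def entropy_h_def by (intro nn_integral_0_iff_AE) measurable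
  also have "\<dots> \<longleftrightarrow> (AE v in N. g v = w v)"
  proof (rule eventually_cong[OF pos(2)])
    fix v
    assume "0 < g v"
    \<comment> \<open>\<open>ennreal x = 0\<close> only says x <= 0, so nonnegativity of the
      divergence is what turns it into x = 0; the weight cancels because \<nu> > 0.\<close>
    then have "0 \<le> entropy_bregman (g v) (w v)" "entropy_bregman (g v) (w v) = 0 \<longleftrightarrow> g v = w v"
      using pos(3) by (simp_all add: entropy_bregman_nonneg entropy_bregman_eq_0_iff)
    with pos(1)[of v] show "ennreal (\<nu> v * entropy_bregman (g v) (w v)) = 0 \<longleftrightarrow> g v = w v"
      by (auto simp: ennreal_eq_0_iff mult_le_0_iff)
  qed
  finally show ?thesis .
qed

section \<open>Velocity moments and Maxwellians\<close>

text \<open>The weight 1 + |v|^2 dominates 1, |v| and |v|^2, hence controls mass, momentum and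
  energy at once. It is applied with u = \<nu> g, \<nu> f and \<nu> M.\<close>

lemma integrable_moments:
  fixes u :: "'a::euclidean_space \<Rightarrow> real"
  assumes [measurable]: "u \<in> borel_measurable lebesgue"
    and int: "integrable lebesgue (\<lambda>v. (1 + (norm v)\<^sup>2) * u v)"
  shows "integrable lebesgue u"
    and "integrable lebesgue (\<lambda>v. u v *\<^sub>R v)"
    and "integrable lebesgue (\<lambda>v. (norm v)\<^sup>2 * u v)"
proof -
  have [measurable]: "(\<lambda>v::'a. v) \<in> borel_measurable lebesgue"
    by (rule measurable_completion) simp
  have abs: "\<bar>(1 + (norm v)\<^sup>2) * u v\<bar> = (1 + (norm v)\<^sup>2) * \<bar>u v\<bar>" for v
    by (simp add: abs_mult)
  have le: "norm v \<le> 1 + (norm v)\<^sup>2" for v :: 'a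
  proof -
    \<comment> \<open>Expansion of (|v| - 1)^2 >= 0.\<close>
    have "2 * norm v \<le> (norm v)\<^sup>2 + 1"
      using zero_le_power2[of "norm v - 1"] by (simp add: power2_diff)
    then show ?thesis
      using norm_ge_zero[of v] by linarith
  qed
  have "\<bar>u v\<bar> \<le> (1 + (norm v)\<^sup>2) * \<bar>u v\<bar>" for v
    by (simp add: distrib_right)
  then show "integrable lebesgue u"
    by (intro Bochner_Integration.integrable_bound[OF int]) (auto simp: abs)
  have "norm (u v *\<^sub>R v) \<le> (1 + (norm v)\<^sup>2) * \<bar>u v\<bar>" for v
    using mult_right_mono[OF le, of "\<bar>u v\<bar>" v] by (simp add: mult.commute)
  then show "integrable lebesgue (\<lambda>v. u v *\<^sub>R v)"
    by (intro Bochner_Integration.integrable_bound[OF int]) (auto simp: abs)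
  have "\<bar>(norm v)\<^sup>2 * u v\<bar> \<le> (1 + (norm v)\<^sup>2) * \<bar>u v\<bar>" for v
    by (simp add: distrib_right abs_mult)
  then show "integrable lebesgue (\<lambda>v. (norm v)\<^sup>2 * u v)"
    by (intro Bochner_Integration.integrable_bound[OF int]) (auto simp: abs)
qed

lemma maxwellian_pos: "0 < maxwellian m l0 l1 l2 v"
  by (simp add: maxwellian_def)

lemma borel_measurable_maxwellian: "maxwellian m l0 l1 l2 \<in> borel_measurable lebesgue"
proof -
  have "maxwellian m l0 l1 l2 \<in> borel_measurable borel"
    unfolding maxwellian_def by measurable
  then show ?thesis
    by (intro measurable_completion) simp
qed

text \<open>The logarithm undoes the exponential and leaves a combination of 1, v and |v|^2, so only
  three moments of u enter.\<close>

lemma integrable_mult_ln_maxwellian: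
  assumes "u \<in> borel_measurable lebesgue"
    and "integrable lebesgue (\<lambda>v. (1 + (norm v)\<^sup>2) * u v)"
  shows "integrable lebesgue (\<lambda>v. u v * ln (maxwellian m l0 l1 l2 v))"
    and "(\<integral>v. u v * ln (maxwellian m l0 l1 l2 v) \<partial>lebesgue) =
      m * (l0 * (\<integral>v. u v \<partial>lebesgue) + l1 \<bullet> (\<integral>v. u v *\<^sub>R v \<partial>lebesgue) +
        l2 * (\<integral>v. (norm v)\<^sup>2 * u v \<partial>lebesgue))"
proof -
  note int = integrable_moments[OF assms]
  have eq: "(\<lambda>v. u v * ln (maxwellian m l0 l1 l2 v)) =
      (\<lambda>v. m * (l0 * u v + l1 \<bullet> (u v *\<^sub>R v) + l2 * ((norm v)\<^sup>2 * u v)))"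
    by (simp add: maxwellian_def algebra_simps)
  show "integrable lebesgue (\<lambda>v. u v * ln (maxwellian m l0 l1 l2 v))"
    unfolding eq using int
    by (intro integrable_mult_right Bochner_Integration.integrable_add integrable_inner_right)
  show "(\<integral>v. u v * ln (maxwellian m l0 l1 l2 v) \<partial>lebesgue) =
      m * (l0 * (\<integral>v. u v \<partial>lebesgue) + l1 \<bullet> (\<integral>v. u v *\<^sub>R v \<partial>lebesgue) +
        l2 * (\<integral>v. (norm v)\<^sup>2 * u v \<partial>lebesgue))"
    \<comment> \<open>Removing \<open>inner_scaleR_right\<close> keeps the vector u(v) v inside the
      inner product, so that the integral can be moved into its second argument.\<close>
    unfolding eq using int
    by (simp add: integrable_inner_right del: inner_scaleR_right)
qed

text \<open>Mass is conserved for each species, so a and b may differ; momentum and energy are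
  conserved only in total, which is why both Maxwellians must share l1 and l2. The mass factor in
  each exponent supplies the weights m1 and m2 of these balances.\<close>

lemma admissible_log_moment_eq:
  assumes "0 < m1" "0 < m2"
    and [measurable]: "\<nu>12 \<in> borel_measurable lebesgue" "\<nu>21 \<in> borel_measurable lebesgue"
      "f1 \<in> borel_measurable lebesgue" "f2 \<in> borel_measurable lebesgue"
    and f: "integrable lebesgue (\<lambda>v. \<nu>12 v * (1 + (norm v)\<^sup>2) * f1 v)"
      "integrable lebesgue (\<lambda>v. \<nu>21 v * (1 + (norm v)\<^sup>2) * f2 v)"
    and g: "(g1, g2) \<in> admissible m1 m2 \<nu>12 \<nu>21 f1 f2"
  shows "(\<integral>v. \<nu>12 v * g1 v * ln (maxwellian m1 a l1 l2 v) \<partial>lebesgue) +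
      (\<integral>v. \<nu>21 v * g2 v * ln (maxwellian m2 b l1 l2 v) \<partial>lebesgue) =
    (\<integral>v. \<nu>12 v * f1 v * ln (maxwellian m1 a l1 l2 v) \<partial>lebesgue) +
      (\<integral>v. \<nu>21 v * f2 v * ln (maxwellian m2 b l1 l2 v) \<partial>lebesgue)"
proof -
  have [measurable]: "g1 \<in> borel_measurable lebesgue" "g2 \<in> borel_measurable lebesgue"
    using g by (simp_all add: admissible_def)
  have f': "integrable lebesgue (\<lambda>v. (1 + (norm v)\<^sup>2) * (\<nu>12 v * f1 v))"
      "integrable lebesgue (\<lambda>v. (1 + (norm v)\<^sup>2) * (\<nu>21 v * f2 v))"
    using f by (simp_all add: mult_ac)
  have g': "integrable lebesgue (\<lambda>v. (1 + (norm v)\<^sup>2) * (\<nu>12 v * g1 v))"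
      "integrable lebesgue (\<lambda>v. (1 + (norm v)\<^sup>2) * (\<nu>21 v * g2 v))"
    using g by (simp_all add: admissible_def mult_ac)
  have m: "(\<lambda>v. \<nu>12 v * f1 v) \<in> borel_measurable lebesgue"
      "(\<lambda>v. \<nu>21 v * f2 v) \<in> borel_measurable lebesgue"
      "(\<lambda>v. \<nu>12 v * g1 v) \<in> borel_measurable lebesgue"
      "(\<lambda>v. \<nu>21 v * g2 v) \<in> borel_measurable lebesgue"
    by measurable
  note mom = integrable_moments[OF m(1) f'(1)] integrable_moments[OF m(2) f'(2)]
    integrable_moments[OF m(3) g'(1)] integrable_moments[OF m(4) g'(2)]
  have mass1: "(\<integral>v. \<nu>12 v * g1 v \<partial>lebesgue) = (\<integral>v. \<nu>12 v * f1 v \<partial>lebesgue)"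
    and mass2: "(\<integral>v. \<nu>21 v * g2 v \<partial>lebesgue) = (\<integral>v. \<nu>21 v * f2 v \<partial>lebesgue)"
    using g assms(1,2) by (simp_all add: admissible_def mult.assoc)
  \<comment> \<open>\<open>admissible\<close> integrates the difference g - f; separating it into a
    moment of g and a moment of f uses the integrability of both.\<close>
  have "m1 *\<^sub>R ((\<integral>v. (\<nu>12 v * g1 v) *\<^sub>R v \<partial>lebesgue) - (\<integral>v. (\<nu>12 v * f1 v) *\<^sub>R v \<partial>lebesgue)) =
      (\<integral>v. m1 *\<^sub>R ((\<nu>12 v * g1 v) *\<^sub>R v - (\<nu>12 v * f1 v) *\<^sub>R v) \<partial>lebesgue)"
    "m2 *\<^sub>R ((\<integral>v. (\<nu>21 v * g2 v) *\<^sub>R v \<partial>lebesgue) - (\<integral>v. (\<nu>21 v * f2 v) *\<^sub>R v \<partial>lebesgue)) =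
      (\<integral>v. m2 *\<^sub>R ((\<nu>21 v * g2 v) *\<^sub>R v - (\<nu>21 v * f2 v) *\<^sub>R v) \<partial>lebesgue)"
    using mom by (simp_all only: Bochner_Integration.integral_diff integral_scaleR_right)
  then have momentum:
    "m1 *\<^sub>R ((\<integral>v. (\<nu>12 v * g1 v) *\<^sub>R v \<partial>lebesgue) - (\<integral>v. (\<nu>12 v * f1 v) *\<^sub>R v \<partial>lebesgue)) +
     m2 *\<^sub>R ((\<integral>v. (\<nu>21 v * g2 v) *\<^sub>R v \<partial>lebesgue) - (\<integral>v. (\<nu>21 v * f2 v) *\<^sub>R v \<partial>lebesgue)) = 0"
    using g by (simp add: admissible_def algebra_simps)
  have "m1 * ((\<integral>v. (norm v)\<^sup>2 * (\<nu>12 v * g1 v) \<partial>lebesgue) - (\<integral>v. (norm v)\<^sup>2 * (\<nu>12 v * f1 v) \<partial>lebesgue)) =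
      (\<integral>v. m1 * ((norm v)\<^sup>2 * (\<nu>12 v * g1 v) - (norm v)\<^sup>2 * (\<nu>12 v * f1 v)) \<partial>lebesgue)"
    "m2 * ((\<integral>v. (norm v)\<^sup>2 * (\<nu>21 v * g2 v) \<partial>lebesgue) - (\<integral>v. (norm v)\<^sup>2 * (\<nu>21 v * f2 v) \<partial>lebesgue)) =
      (\<integral>v. m2 * ((norm v)\<^sup>2 * (\<nu>21 v * g2 v) - (norm v)\<^sup>2 * (\<nu>21 v * f2 v)) \<partial>lebesgue)"
    using mom by (simp_all only: Bochner_Integration.integral_diff integral_mult_right_zero)
  then have energy:
    "m1 * ((\<integral>v. (norm v)\<^sup>2 * (\<nu>12 v * g1 v) \<partial>lebesgue) - (\<integral>v. (norm v)\<^sup>2 * (\<nu>12 v * f1 v) \<partial>lebesgue)) +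
     m2 * ((\<integral>v. (norm v)\<^sup>2 * (\<nu>21 v * g2 v) \<partial>lebesgue) - (\<integral>v. (norm v)\<^sup>2 * (\<nu>21 v * f2 v) \<partial>lebesgue)) = 0"
    using g by (simp add: admissible_def algebra_simps)
  note ln_moments = integrable_mult_ln_maxwellian(2)[OF m(1) f'(1)]
    integrable_mult_ln_maxwellian(2)[OF m(2) f'(2)]
    integrable_mult_ln_maxwellian(2)[OF m(3) g'(1)]
    integrable_mult_ln_maxwellian(2)[OF m(4) g'(2)]
  show ?thesis
    unfolding ln_moments mass1 mass2
    \<comment> \<open>Once the masses are matched, the two sides differ exactly by l1 paired with
      the momentum balance plus l2 times the energy balance.\<close>
    using arg_cong[OF momentum, of "\<lambda>x. l1 \<bullet> x"] arg_cong[OF energy, of "\<lambda>x. l2 * x"]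
    by (simp add: inner_diff_right inner_add_right algebra_simps)
qed

section \<open>Minimality and uniqueness of the Maxwellian pair\<close>

theorem theorem2p2:
  fixes m1 m2 :: real
    and \<nu>12 \<nu>21 f1 f2 M12 M21 :: "real^3 \<Rightarrow> real"
    and l0_12 l0_21 l2_12 l2_21 :: real
    and l1_12 l1_21 :: "real^3"
  assumes "m1 > 0" and "m2 > 0"
    and "\<nu>12 \<in> borel_measurable lebesgue" and "\<nu>21 \<in> borel_measurable lebesgue"
    and "\<And>v. \<nu>12 v > 0" and "\<And>v. \<nu>21 v > 0"
    and "f1 \<in> borel_measurable lebesgue" and "f2 \<in> borel_measurable lebesgue"
    and "\<And>v. f1 v \<ge> 0" and "\<And>v. f2 v \<ge> 0"
    and "integrable lebesgue (\<lambda>v. \<nu>12 v * (1 + (norm v)\<^sup>2) * f1 v)"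
    and "integrable lebesgue (\<lambda>v. \<nu>21 v * (1 + (norm v)\<^sup>2) * f2 v)"
    and "l1_12 = l1_21" and "l2_12 = l2_21"
    and "M12 = maxwellian m1 l0_12 l1_12 l2_12"
    and "M21 = maxwellian m2 l0_21 l1_21 l2_21"
    and "(M12, M21) \<in> admissible m1 m2 \<nu>12 \<nu>21 f1 f2"
  shows "is_arg_min (entropy_functional \<nu>12 \<nu>21)
           (\<lambda>g. g \<in> admissible m1 m2 \<nu>12 \<nu>21 f1 f2) (M12, M21) \<and>
         (\<forall>g1 g2. is_arg_min (entropy_functional \<nu>12 \<nu>21)
             (\<lambda>g. g \<in> admissible m1 m2 \<nu>12 \<nu>21 f1 f2) (g1, g2) \<longrightarrow>
           (AE v in lebesgue. g1 v = M12 v) \<and> (AE v in lebesgue. g2 v = M21 v))"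
proof -
  let ?X = "admissible m1 m2 \<nu>12 \<nu>21 f1 f2"
  let ?F = "entropy_functional \<nu>12 \<nu>21"
  define B1 where "B1 g = (\<integral>\<^sup>+ v. ennreal (\<nu>12 v * entropy_bregman (g v) (M12 v)) \<partial>lebesgue)" for g
  define B2 where "B2 g = (\<integral>\<^sup>+ v. ennreal (\<nu>21 v * entropy_bregman (g v) (M21 v)) \<partial>lebesgue)" for g
  \<comment> \<open>C is written with f1 and f2 instead of g1 and g2, which makes it visibly the
    same for all admissible pairs.\<close>
  define C where "C = (\<integral>v. \<nu>12 v * f1 v * ln (M12 v) \<partial>lebesgue) + (\<integral>v. \<nu>21 v * f2 v * ln (M21 v) \<partial>lebesgue)
    - (\<integral>v. \<nu>12 v * M12 v \<partial>lebesgue) - (\<integral>v. \<nu>21 v * M21 v \<partial>lebesgue)"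
  note [measurable] = assms(3,4,7,8)
  have M_meas [measurable]: "M12 \<in> borel_measurable lebesgue" "M21 \<in> borel_measurable lebesgue"
    using assms(15,16) by (simp_all add: borel_measurable_maxwellian)
  have M_pos: "0 < M12 v" "0 < M21 v" for v
    using assms(15,16) by (simp_all add: maxwellian_pos)
  have M_int: "integrable lebesgue (\<lambda>v. \<nu>12 v * M12 v)" "integrable lebesgue (\<lambda>v. \<nu>21 v * M21 v)"
    by (rule integrable_moments(1); use assms(17) in \<open>simp add: admissible_def mult_ac\<close>)+
  \<comment> \<open>Entropy is a finite constant plus an excess in [0, \<infinity>]; minimality and
    uniqueness are both read off from this identity.\<close>
  have F_eq: "?F (g1, g2) = ereal C + enn2ereal (B1 g1 + B2 g2)" if g: "(g1, g2) \<in> ?X" for g1 g2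
  proof -
    have gm [measurable]: "g1 \<in> borel_measurable lebesgue" "g2 \<in> borel_measurable lebesgue"
      and gp: "AE v in lebesgue. 0 < g1 v" "AE v in lebesgue. 0 < g2 v"
      using g by (simp_all add: admissible_def)
    have int1: "integrable lebesgue (\<lambda>v. \<nu>12 v * g1 v * ln (M12 v))"
      unfolding assms(15)
      by (rule integrable_mult_ln_maxwellian(1), measurable)
        (use g in \<open>simp add: admissible_def mult_ac\<close>)
    have int2: "integrable lebesgue (\<lambda>v. \<nu>21 v * g2 v * ln (M21 v))"
      unfolding assms(16)
      by (rule integrable_mult_ln_maxwellian(1), measurable)
        (use g in \<open>simp add: admissible_def mult_ac\<close>)
    have "(\<integral>v. \<nu>12 v * g1 v * ln (M12 v) \<partial>lebesgue) + (\<integral>v. \<nu>21 v * g2 v * ln (M21 v) \<partial>lebesgue) =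
        (\<integral>v. \<nu>12 v * f1 v * ln (M12 v) \<partial>lebesgue) + (\<integral>v. \<nu>21 v * f2 v * ln (M21 v) \<partial>lebesgue)"
      \<comment> \<open>The equalities of the coefficients bring both Maxwellians to the common l1
        and l2 required by the moment identity.\<close>
      unfolding assms(13-16)
      by (rule admissible_log_moment_eq[OF assms(1-4,7,8,11,12) g])
    \<comment> \<open>C is regrouped by species to match the two separate decompositions.\<close>
    then have C: "C = ((\<integral>v. \<nu>12 v * g1 v * ln (M12 v) \<partial>lebesgue) - (\<integral>v. \<nu>12 v * M12 v \<partial>lebesgue)) +
        ((\<integral>v. \<nu>21 v * g2 v * ln (M21 v) \<partial>lebesgue) - (\<integral>v. \<nu>21 v * M21 v \<partial>lebesgue))"
      by (simp add: C_def)
    show ?thesis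
      unfolding entropy_functional_def prod.case C B1_def B2_def plus_ennreal.rep_eq
        entropy_integral_eq_affine_plus_bregman[OF assms(3) gm(1) M_meas(1) assms(5) gp(1) M_pos(1) int1 M_int(1)]
        entropy_integral_eq_affine_plus_bregman[OF assms(4) gm(2) M_meas(2) assms(6) gp(2) M_pos(2) int2 M_int(2)]
      by (simp only: plus_ereal.simps(1)[symmetric] ac_simps)
  qed
  have "B1 M12 = 0" "B2 M21 = 0"
    by (simp_all add: B1_def B2_def entropy_bregman_eq M_pos less_imp_neq[OF M_pos(1), symmetric]
        less_imp_neq[OF M_pos(2), symmetric])
  then have F_M: "?F (M12, M21) = ereal C"
    using F_eq[OF assms(17)] by (simp add: zero_ennreal.rep_eq)
  have min: "?F (M12, M21) \<le> ?F (g1, g2)" if "(g1, g2) \<in> ?X" for g1 g2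
    unfolding F_M F_eq[OF that] by (rule ereal_le_add_self) simp
  have unique: "(AE v in lebesgue. g1 v = M12 v) \<and> (AE v in lebesgue. g2 v = M21 v)"
    if g: "(g1, g2) \<in> ?X" and le: "?F (g1, g2) \<le> ?F (M12, M21)" for g1 g2
  proof -
    \<comment> \<open>C is a real number and can be cancelled from C + excess <= C; this also
      excludes an infinite excess.\<close>
    have "enn2ereal (B1 g1 + B2 g2) \<le> 0"
      using le unfolding F_M F_eq[OF g] by (cases "enn2ereal (B1 g1 + B2 g2)") auto
    then have "B1 g1 + B2 g2 \<le> 0"
      by (simp add: less_eq_ennreal.rep_eq zero_ennreal.rep_eq)
    then have "B1 g1 = 0" "B2 g2 = 0"
      by simp_all
    moreover have "g1 \<in> borel_measurable lebesgue" "g2 \<in> borel_measurable lebesgue"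
        "AE v in lebesgue. 0 < g1 v" "AE v in lebesgue. 0 < g2 v"
      using g by (simp_all add: admissible_def)
    ultimately show ?thesis
      unfolding B1_def B2_def
      by (simp add: bregman_integral_eq_0_iff assms(3-6) M_meas M_pos)
  qed
  show ?thesis
    \<comment> \<open>\<open>is_arg_min\<close> says that no admissible pair has a strictly smaller
      value. For another minimizer, comparison with (M12, M21) therefore gives the inequality that
      \<open>unique\<close> asks for.\<close>
    using assms(17) min unique by (auto simp: is_arg_min_def not_less)
qed

end
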